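(* Let $\mathbb{P}=\{2,3,5,\ldots\}$ be the set of primes. For each $\alpha\in[0,1]$ there exists a set $A\subseteq\mathbb{N}$ such that $A$ has asymptotic density, the sumset $A+\mathbb{P}$ has asymptotic density, and $\mathsf{d}(A+\mathbb{P})=\alpha$.
   Context: $\mathbb{N}=\{0,1,2,\ldots\}$ denotes the non-negative integers. A set $X\subseteq\mathbb{N}$ has asymptotic density if the limit $\mathsf{d}(X):=\lim_{n\to\infty}\frac{1}{n}\bigl|X\cap[1,n]\bigr|$ exists, and then $\mathsf{d}(X)$ is its asymptotic density. For $X,Y\subseteq\mathbb{N}$, the sumset is $X+Y:=\{x+y: x\in X,\ y\in Y\}$. *)

theory Defs
  imports
    Complex_Main
    "HOL-Library.Set_Algebras"
    "HOL-Computational_Algebra.Primes"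
begin

text \<open>
  The counting interval is \<open>[1, n]\<close>, so membership of \<open>0\<close> is irrelevant.
  The value of the quotient at \<open>n = 0\<close> is the junk value \<open>0 / 0 = 0\<close> and does
  not affect the limit.  The sumset of two sets is \<^const>\<open>plus\<close> on sets, from
  \<^theory>\<open>HOL-Library.Set_Algebras\<close>.
\<close>

definition density_ratio :: "nat set \<Rightarrow> nat \<Rightarrow> real" where
  "density_ratio X n = real (card (X \<inter> {1..n})) / real n"

definition has_asymptotic_density :: "nat set \<Rightarrow> bool" where
  "has_asymptotic_density X \<longleftrightarrow> convergent (density_ratio X)"

text \<open>Meaningful only for sets satisfying \<^const>\<open>has_asymptotic_density\<close>.\<close>

definition asymptotic_density :: "nat set \<Rightarrow> real" where
  "asymptotic_density X = lim (density_ratio X)"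

end

theory Submission
  imports Defs "HOL-Analysis.Harmonic_Numbers" "HOL-Number_Theory.Totient"
begin

text \<open>
  For suitable moduli \<open>q\<close>, here \<open>q = k!\<close>, the primes occupy only \<open>o(q)\<close> residue classes.
  Deleting residue classes from a periodic set \<open>T\<close> one at a time therefore changes the density of
  \<open>T + \<P>\<close> in steps of size \<open>o(1)\<close>, which yields a decreasing sequence of \<open>k!\<close>-periodic sets
  \<open>T k\<close> for which the density of \<open>T k + \<P>\<close> decreases to \<open>\<alpha>\<close>. The set \<open>A\<close> follows \<open>T k\<close> on a
  stretch \<open>[N k, N (k + 1))\<close> with \<open>N\<close> growing fast enough; initial segments of \<open>A\<close> do not matter
  because the primes have density \<open>0\<close>.
\<close>

section \<open>Asymptotic density\<close>

abbreviation has_density :: "nat set \<Rightarrow> real \<Rightarrow> bool" where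
  "has_density X d \<equiv> density_ratio X \<longlonglongrightarrow> d"

lemma density_ratio_nonneg: "0 \<le> density_ratio X n"
  by (simp add: density_ratio_def)

lemma density_ratio_mono:
  assumes "X \<inter> {1..n} \<subseteq> Y"
  shows "density_ratio X n \<le> density_ratio Y n"
  unfolding density_ratio_def
  using assms by (intro divide_right_mono) (auto intro!: card_mono)

lemma density_ratio_Un: "density_ratio (X \<union> Y) n \<le> density_ratio X n + density_ratio Y n"
proof -
  have "card ((X \<union> Y) \<inter> {1..n}) \<le> card (X \<inter> {1..n}) + card (Y \<inter> {1..n})"
    by (simp add: Int_Un_distrib2 card_Un_le)
  then show ?thesis
    unfolding density_ratio_def add_divide_distrib[symmetric]
    by (intro divide_right_mono) (simp_all flip: of_nat_add)
qed

lemma has_density_zero_Un: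
  assumes "has_density X 0" and "has_density Y 0"
  shows "has_density (X \<union> Y) 0"
proof (rule tendsto_sandwich[OF _ _ tendsto_const])
  show "(\<lambda>n. density_ratio X n + density_ratio Y n) \<longlonglongrightarrow> 0"
    using tendsto_add[OF assms] by simp
qed (simp_all add: density_ratio_nonneg density_ratio_Un)

lemma has_density_of_bounded_error:
  fixes d c :: real
  assumes "\<And>n. \<bar>real (card (X \<inter> {1..n})) - d * real n\<bar> \<le> c"
  shows "has_density X d"
proof -
  have "(\<lambda>n. density_ratio X n - d) \<longlonglongrightarrow> 0"
  proof (rule Lim_null_comparison)
    show "(\<lambda>n. c / real n) \<longlonglongrightarrow> 0"
      by (rule lim_const_over_n)
    show "\<forall>\<^sub>F n in sequentially. norm (density_ratio X n - d) \<le> c / real n"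
      using eventually_gt_at_top[of 0]
    proof eventually_elim
      case (elim n)
      then have "density_ratio X n - d = (real (card (X \<inter> {1..n})) - d * real n) / real n"
        by (simp add: density_ratio_def field_simps)
      then show ?case
        using assms[of n] elim by (simp add: divide_right_mono)
    qed
  qed
  then show ?thesis
    by (rule LIM_zero_cancel)
qed

lemma has_density_finite:
  assumes "finite X"
  shows "has_density X 0"
  by (rule has_density_of_bounded_error[where c = "real (card X)"])
    (use assms in \<open>auto intro: card_mono\<close>)

lemma has_density_superset_finite:
  assumes "has_density X d" and "Y \<subseteq> X" and "finite (X - Y)"
  shows "has_density Y d"
proof (rule tendsto_sandwich[OF _ _ _ assms(1)])
  show "\<forall>\<^sub>F n in sequentially. density_ratio Y n \<le> density_ratio X n"
    using assms(2) by (intro always_eventually allI density_ratio_mono) auto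
  have "density_ratio X n \<le> density_ratio Y n + density_ratio (X - Y) n" for n
    using density_ratio_Un[of Y "X - Y" n] assms(2) by (simp add: Un_absorb1)
  then show "\<forall>\<^sub>F n in sequentially. density_ratio X n - density_ratio (X - Y) n \<le> density_ratio Y n"
    by (simp add: algebra_simps)
  show "(\<lambda>n. density_ratio X n - density_ratio (X - Y) n) \<longlonglongrightarrow> d"
    using tendsto_diff[OF assms(1) has_density_finite[OF assms(3)]] by simp
qed

lemma has_density_zero_translate:
  assumes "has_density B 0"
  shows "has_density ({a} + B) 0"
proof (rule tendsto_sandwich[OF _ _ tendsto_const])
  show "\<forall>\<^sub>F n in sequentially. density_ratio ({a} + B) n \<le> density_ratio B n + 1 / real n"
  proof (intro always_eventually allI)
    fix n
    \<comment> \<open>The summand from \<open>B\<close> may be 0, which \<open>{1..n}\<close> does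
      not count; this costs the extra \<open>1 / n\<close>.\<close>
    have "({a} + B) \<inter> {1..n} \<subseteq> (+) a ` insert 0 (B \<inter> {1..n})"
      by (auto simp: set_plus_def)
    then have "card (({a} + B) \<inter> {1..n}) \<le> card (insert 0 (B \<inter> {1..n}))"
      by (rule surj_card_le[rotated]) simp
    also have "\<dots> \<le> card (B \<inter> {1..n}) + 1"
      by (simp add: card_insert_if)
    finally show "density_ratio ({a} + B) n \<le> density_ratio B n + 1 / real n"
      unfolding density_ratio_def add_divide_distrib[symmetric]
      by (intro divide_right_mono) (simp_all flip: of_nat_Suc)
  qed
  show "(\<lambda>n. density_ratio B n + 1 / real n) \<longlonglongrightarrow> 0"
    using tendsto_add[OF assms lim_const_over_n[of 1]] by simp
qed (simp add: density_ratio_nonneg)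

text \<open>Makes the contribution of a finite initial segment of \<open>A\<close> to
  \<open>A + B\<close> negligible.\<close>

lemma has_density_zero_finite_plus:
  assumes "finite F" and "has_density B 0"
  shows "has_density (F + B) 0"
  using assms(1)
proof induction
  case empty
  have "{} + B = {}"
    by (auto simp: set_plus_def)
  then show ?case
    using has_density_finite[of "{}"] by simp
next
  case (insert a F)
  have "insert a F + B = ({a} + B) \<union> (F + B)"
    by (auto simp: set_plus_def)
  then show ?case
    using has_density_zero_Un[OF has_density_zero_translate[OF assms(2)] insert.IH] by simp
qed

section \<open>Gluing a sequence of sets\<close>

text \<open>For the upper estimate one fixed \<open>k\<close> with \<open>y k\<close> close to
  \<open>d\<close> suffices, since \<open>X\<close> exceeds \<open>Y k\<close> only by a null set.
  For the lower estimate \<open>k\<close> varies with \<open>n\<close>: on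
  \<open>[N k, N (k + 1))\<close> the set \<open>X\<close> contains \<open>Y k\<close> up to
  \<open>n\<close>, and the ratio of \<open>Y k\<close> is already close to \<open>y k\<close>. The
  exceptional set \<open>Z\<close> need only be null, not finite, so that the lemma serves both for
  \<open>A\<close> and for \<open>A + B\<close>.\<close>

lemma has_density_glue:
  fixes N :: "nat \<Rightarrow> nat"
  assumes Y: "\<And>k. has_density (Y k) (y k)" and y: "y \<longlonglongrightarrow> d"
    and upper: "\<And>k. \<exists>Z. has_density Z 0 \<and> X \<subseteq> Z \<union> Y k"
    and N: "strict_mono N"
    and lower: "\<And>k n. n < N (Suc k) \<Longrightarrow> Y k \<inter> {1..n} \<subseteq> X"
    and conv: "\<And>k n. N k \<le> n \<Longrightarrow> y k - 1 / real (Suc k) \<le> density_ratio (Y k) n"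
  shows "has_density X d"
proof (rule order_tendstoI)
  fix a assume "d < a"
  then obtain k where k: "y k < a"
    using eventually_happens'[OF sequentially_bot order_tendstoD(2)[OF y]] by blast
  obtain Z where Z: "has_density Z 0" "X \<subseteq> Z \<union> Y k"
    using upper by blast
  have "(\<lambda>n. density_ratio Z n + density_ratio (Y k) n) \<longlonglongrightarrow> y k"
    using tendsto_add[OF Z(1) Y[of k]] by simp
  then have "\<forall>\<^sub>F n in sequentially. density_ratio Z n + density_ratio (Y k) n < a"
    using k order_tendstoD(2) by blast
  then show "\<forall>\<^sub>F n in sequentially. density_ratio X n < a"
  proof eventually_elim
    case (elim n)
    have "density_ratio X n \<le> density_ratio (Z \<union> Y k) n"
      using Z(2) by (intro density_ratio_mono) auto
    then show ?case
      using density_ratio_Un[of Z "Y k" n] elim by linarith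
  qed
next
  fix a assume "a < d"
  have "(\<lambda>k. y k - 1 / real (Suc k)) \<longlonglongrightarrow> d"
    using tendsto_diff[OF y LIMSEQ_Suc[OF lim_const_over_n[of 1]]] by simp
  then obtain K where K: "\<And>k. K \<le> k \<Longrightarrow> a < y k - 1 / real (Suc k)"
    using order_tendstoD(1)[of _ d sequentially a] \<open>a < d\<close> unfolding eventually_sequentially by metis
  show "\<forall>\<^sub>F n in sequentially. a < density_ratio X n"
    using eventually_ge_at_top[of "N K"]
  proof eventually_elim
    case (elim n)
    \<comment> \<open>The stage whose stretch \<open>[N k, N (k + 1))\<close> contains
      \<open>n\<close>; the maximum exists because \<open>j \<le> N j\<close>.\<close>
    define k where "k = (GREATEST k. N k \<le> n)"
    have bound: "\<And>j. N j \<le> n \<Longrightarrow> j \<le> n"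
      using strict_mono_imp_increasing[OF N] le_trans by blast
    have k: "N k \<le> n" "K \<le> k"
      unfolding k_def using GreatestI_nat[of "\<lambda>k. N k \<le> n", OF elim bound]
        Greatest_le_nat[of "\<lambda>k. N k \<le> n", OF elim bound] by blast+
    have "\<not> N (Suc k) \<le> n"
      using Greatest_le_nat[of "\<lambda>k. N k \<le> n", OF _ bound, of "Suc k"] unfolding k_def by auto
    then have "density_ratio (Y k) n \<le> density_ratio X n"
      by (intro density_ratio_mono lower) simp
    then show ?case
      using K[OF k(2)] conv[OF k(1)] by linarith
  qed
qed

lemma has_density_decreasing_limit:
  fixes T :: "nat \<Rightarrow> nat set"
  assumes decr: "decseq T" and B: "has_density B 0"
    and t: "\<And>k. has_density (T k) (t k)" "t \<longlonglongrightarrow> d"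
    and s: "\<And>k. has_density (T k + B) (s k)" "s \<longlonglongrightarrow> e"
  obtains A where "has_density A d" and "has_density (A + B) e"
proof -
  have ev: "\<exists>M. \<forall>n\<ge>M. x - 1 / real (Suc k) \<le> density_ratio X n"
    if "has_density X x" for X x k
  proof -
    have "x - 1 / real (Suc k) < x" by simp
    from order_tendstoD(1)[OF that this] show ?thesis
      unfolding eventually_sequentially by (meson less_imp_le)
  qed
  have "\<forall>k. \<exists>M. \<forall>n\<ge>M. t k - 1 / real (Suc k) \<le> density_ratio (T k) n"
    using ev[OF t(1)] by blast
  then obtain M1 where M1: "\<And>k n. M1 k \<le> n \<Longrightarrow> t k - 1 / real (Suc k) \<le> density_ratio (T k) n"
    by metis
  have "\<forall>k. \<exists>M. \<forall>n\<ge>M. s k - 1 / real (Suc k) \<le> density_ratio (T k + B) n"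
    using ev[OF s(1)] by blast
  then obtain M2 where M2: "\<And>k n. M2 k \<le> n \<Longrightarrow> s k - 1 / real (Suc k) \<le> density_ratio (T k + B) n"
    by metis
  \<comment> \<open>The sum dominates both thresholds of stage \<open>k\<close>, and the
    \<open>+ 1\<close> makes \<open>N\<close> strictly increasing.\<close>
  define N where "N k = (\<Sum>j\<le>k. M1 j + M2 j + 1)" for k
  have N: "strict_mono N"
    unfolding strict_mono_Suc_iff by (simp add: N_def)
  have N_ge: "M1 k + M2 k \<le> N k" for k
    unfolding N_def by (cases k) auto
  \<comment> \<open>As \<open>T\<close> decreases, only the largest \<open>k\<close> with
    \<open>N k \<le> n\<close> matters, so \<open>A\<close> agrees with \<open>T k\<close> on
    \<open>[N k, N (k + 1))\<close>; below \<open>N 0\<close> it contains everything.\<close>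
  define A where "A = {n. \<forall>k. N k \<le> n \<longrightarrow> n \<in> T k}"
  have A_upper: "A \<subseteq> {..<N k} \<union> T k" for k
    unfolding A_def using not_less by blast
  have A_lower: "m \<in> A" if "m \<in> T k" "m < N (Suc k)" for m k
    unfolding A_def
  proof safe
    fix j assume "N j \<le> m"
    then have "j \<le> k"
      using that(2) strict_mono_less[OF N, of j "Suc k"] by linarith
    then show "m \<in> T j"
      using decr that(1) by (auto simp: decseq_def)
  qed
  have "has_density A d"
  proof (rule has_density_glue[OF t(1) t(2) _ N])
    show "\<exists>Z. has_density Z 0 \<and> A \<subseteq> Z \<union> T k" for k
      using A_upper[of k] has_density_finite[of "{..<N k}"] by blast
    show "T k \<inter> {1..n} \<subseteq> A" if "n < N (Suc k)" for k n
      using A_lower[of _ k] that by auto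
    show "t k - 1 / real (Suc k) \<le> density_ratio (T k) n" if "N k \<le> n" for k n
      using M1 that N_ge[of k] by simp
  qed
  moreover have "has_density (A + B) e"
  proof (rule has_density_glue[OF s(1) s(2) _ N])
    show "\<exists>Z. has_density Z 0 \<and> A + B \<subseteq> Z \<union> (T k + B)" for k
    proof (intro exI conjI)
      show "has_density ({..<N k} + B) 0"
        using B by (rule has_density_zero_finite_plus[rotated]) simp
      show "A + B \<subseteq> ({..<N k} + B) \<union> (T k + B)"
        using A_upper[of k] unfolding set_plus_def by fast
    qed
    show "(T k + B) \<inter> {1..n} \<subseteq> A + B" if "n < N (Suc k)" for k n
    proof
      fix x assume "x \<in> (T k + B) \<inter> {1..n}"
      then obtain u v where "x = u + v" "u \<in> T k" "v \<in> B" "u + v \<le> n"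
        by (auto simp: set_plus_def)
      \<comment> \<open>A sum that is at most \<open>n\<close> has
        \<open>u \<le> n < N (Suc k)\<close>, and in that range \<open>T k\<close> is contained in
        \<open>A\<close>.\<close>
      moreover from this have "u \<in> A"
        using that by (intro A_lower[of u k]) linarith+
      ultimately show "x \<in> A + B"
        by (auto simp: set_plus_def)
    qed
    show "s k - 1 / real (Suc k) \<le> density_ratio (T k + B) n" if "N k \<le> n" for k n
      using M2 that N_ge[of k] by simp
  qed
  ultimately show ?thesis ..
qed

section \<open>Periodic sets\<close>

definition periodic_set :: "nat \<Rightarrow> nat set \<Rightarrow> nat set" where
  "periodic_set q R = {n. n mod q \<in> R}"

definition residues_of :: "nat set \<Rightarrow> nat \<Rightarrow> nat set" where
  "residues_of B q = (\<lambda>b. b mod q) ` B"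

text \<open>For \<open>0 < q\<close> this is the sumset of \<open>R\<close> and \<open>B\<close> in
  Z/qZ, in representatives below \<open>q\<close>.\<close>

definition sum_residues :: "nat set \<Rightarrow> nat \<Rightarrow> nat set \<Rightarrow> nat set" where
  "sum_residues B q R = (\<lambda>(r, b). (r + b) mod q) ` (R \<times> B)"

lemma sum_residuesI: "r \<in> R \<Longrightarrow> b \<in> B \<Longrightarrow> (r + b) mod q \<in> sum_residues B q R"
  unfolding sum_residues_def by (rule image_eqI[of _ _ "(r, b)"]) auto

lemma residues_of_subset: "0 < q \<Longrightarrow> residues_of B q \<subseteq> {..<q}"
  by (auto simp: residues_of_def)

lemma sum_residues_subset: "0 < q \<Longrightarrow> sum_residues B q R \<subseteq> {..<q}"
  by (auto simp: sum_residues_def)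

lemma finite_residues_of: "0 < q \<Longrightarrow> finite (residues_of B q)"
  by (rule finite_subset[OF residues_of_subset]) simp_all

lemma finite_sum_residues: "0 < q \<Longrightarrow> finite (sum_residues B q R)"
  by (rule finite_subset[OF sum_residues_subset]) simp_all

lemma card_periodic_set_below:
  assumes "R \<subseteq> {..<q}"
  shows "card (periodic_set q R \<inter> {..<q * t}) = t * card R"
proof (induction t)
  case (Suc t)
  have fin: "finite R" using assms finite_subset by blast
  have "periodic_set q R \<inter> {..<q * Suc t} = (periodic_set q R \<inter> {..<q * t}) \<union> (+) (q * t) ` R"
  proof (intro equalityI subsetI)
    fix x assume x: "x \<in> periodic_set q R \<inter> {..<q * Suc t}"
    show "x \<in> (periodic_set q R \<inter> {..<q * t}) \<union> (+) (q * t) ` R"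
    proof (cases "x < q * t")
      case False
      then obtain r where r: "x = q * t + r" using le_Suc_ex not_less by blast
      with x have "r < q" by simp
      with r x have "r \<in> R" by (simp add: periodic_set_def)
      with r show ?thesis by blast
    qed (use x in auto)
  qed (use assms in \<open>auto simp: periodic_set_def\<close>)
  moreover have "(periodic_set q R \<inter> {..<q * t}) \<inter> (+) (q * t) ` R = {}"
    by auto
  ultimately show ?case
    using Suc fin by (simp add: card_Un_disjoint card_image)
qed simp

lemma has_density_periodic_set:
  assumes "R \<subseteq> {..<q}" and "0 < q"
  shows "has_density (periodic_set q R) (card R / q)"
proof (rule has_density_of_bounded_error)
  fix n
  let ?X = "periodic_set q R"
  \<comment> \<open>The count and \<open>card R * n / q\<close> both lie between
    \<open>t * card R - 1\<close> and \<open>(t + 1) * card R\<close>. The \<open>- 1\<close>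
    accounts for 0, which \<open>{1..n}\<close> omits.\<close>
  define t where "t = n div q"
  have "card (?X \<inter> {1..n}) \<le> card (?X \<inter> {..<q * Suc t})"
    unfolding t_def using assms(2) dividend_less_times_div[of q n]
    by (intro card_mono) auto
  then have up: "card (?X \<inter> {1..n}) \<le> Suc t * card R"
    using card_periodic_set_below[OF assms(1), of "Suc t"] by simp
  have "q * t \<le> n" by (simp add: t_def)
  then have "?X \<inter> {..<q * t} \<subseteq> insert 0 (?X \<inter> {1..n})"
    by auto
  then have "card (?X \<inter> {..<q * t}) \<le> card (insert 0 (?X \<inter> {1..n}))"
    by (intro card_mono) auto
  also have "\<dots> \<le> card (?X \<inter> {1..n}) + 1"
    by (simp add: card_insert_if)
  finally have low: "t * card R \<le> card (?X \<inter> {1..n}) + 1"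
    using card_periodic_set_below[OF assms(1), of t] by simp
  have "real q * real t \<le> real n"
    using \<open>q * t \<le> n\<close> by (simp flip: of_nat_mult)
  then have "real t \<le> real n / real q"
    using assms(2) by (simp add: field_simps)
  then have t1: "real t * real (card R) \<le> real n / real q * real (card R)"
    by (rule mult_right_mono) simp
  have "n \<le> q * Suc t"
    unfolding t_def using assms(2) dividend_less_times_div[of q n] by simp
  then have "real n \<le> real q * real (Suc t)"
    by (simp only: flip: of_nat_mult of_nat_le_iff[where 'a = real])
  then have "real n / real q \<le> real (Suc t)"
    using assms(2) by (simp add: field_simps)
  then have t2: "real n / real q * real (card R) \<le> real (Suc t) * real (card R)"
    by (rule mult_right_mono) simp
  have up': "real (card (?X \<inter> {1..n})) \<le> real (Suc t) * real (card R)"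
    using up by (simp only: flip: of_nat_mult of_nat_le_iff[where 'a = real])
  have low': "real t * real (card R) \<le> real (card (?X \<inter> {1..n})) + 1"
    using low by (metis of_nat_1 of_nat_add of_nat_le_iff of_nat_mult)
  show "\<bar>real (card (?X \<inter> {1..n})) - real (card R) / real q * real n\<bar> \<le> real (card R) + 1"
    using t1 t2 up' low' by (simp add: algebra_simps abs_le_iff)
qed

text \<open>Once a class modulo \<open>q\<close> is hit by some \<open>r + b\<close>, every element
  of that class from \<open>b\<close> on is a sum with the same \<open>b\<close>. One such
  \<open>b\<close> for each of the finitely many classes shows that the sumset is periodic up to a
  finite set.\<close>

lemma has_density_periodic_set_plus:
  assumes "R \<subseteq> {..<q}" and "0 < q"
  shows "has_density (periodic_set q R + B) (card (sum_residues B q R) / q)"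
proof (rule has_density_superset_finite)
  let ?S = "sum_residues B q R"
  show "has_density (periodic_set q ?S) (card ?S / q)"
    by (intro has_density_periodic_set sum_residues_subset assms(2))
  show "periodic_set q R + B \<subseteq> periodic_set q ?S"
  proof
    fix x assume "x \<in> periodic_set q R + B"
    then obtain a b where x: "x = a + b" "a mod q \<in> R" "b \<in> B"
      by (auto simp: set_plus_def periodic_set_def)
    have "x mod q = (a mod q + b) mod q"
      by (simp add: x(1) mod_add_left_eq)
    with sum_residuesI[OF x(2,3)] show "x \<in> periodic_set q ?S"
      by (simp add: periodic_set_def)
  qed
  have "\<forall>s\<in>?S. \<exists>b. b \<in> B \<and> (\<exists>r\<in>R. s = (r + b) mod q)"
    by (auto simp: sum_residues_def)
  then obtain f where f: "\<And>s. s \<in> ?S \<Longrightarrow> f s \<in> B \<and> (\<exists>r\<in>R. s = (r + f s) mod q)"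
    by metis
  have "periodic_set q ?S - (periodic_set q R + B) \<subseteq> (\<Union>s\<in>?S. {..<f s})"
  proof
    fix x assume x: "x \<in> periodic_set q ?S - (periodic_set q R + B)"
    then have s: "x mod q \<in> ?S" by (simp add: periodic_set_def)
    with f obtain r where r: "f (x mod q) \<in> B" "r \<in> R" "x mod q = (r + f (x mod q)) mod q"
      by blast
    have "x < f (x mod q)"
    proof (rule ccontr)
      assume "\<not> x < f (x mod q)"
      then obtain a where a: "x = a + f (x mod q)"
        by (metis le_Suc_ex add.commute not_less)
      then have "(a + f (x mod q)) mod q = (r + f (x mod q)) mod q"
        using r(3) by simp
      then have "a mod q = r mod q"
        by (metis cong_add_rcancel_nat cong_def)
      also have "\<dots> = r"
        using r(2) assms(1) by auto
      finally have "a \<in> periodic_set q R"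
        using r(2) by (simp add: periodic_set_def)
      then have "x \<in> periodic_set q R + B"
        using a r(1) set_plus_intro by metis
      then show False using x by blast
    qed
    then show "x \<in> (\<Union>s\<in>?S. {..<f s})" using s by blast
  qed
  moreover have "finite ?S"
    using assms(2) by (rule finite_sum_residues)
  ultimately show "finite (periodic_set q ?S - (periodic_set q R + B))"
    by (elim finite_subset) simp
qed

section \<open>Deleting residues and refining the modulus\<close>

lemma card_sum_residues_remove:
  assumes "0 < q"
  shows "card (sum_residues B q R) \<le> card (sum_residues B q (R - {r})) + card (residues_of B q)"
proof -
  \<comment> \<open>The only sums that can be lost are those with first summand \<open>r\<close>;
    they form a translate of the residues of \<open>B\<close>.\<close>
  have "sum_residues B q R \<subseteq> sum_residues B q (R - {r}) \<union> (\<lambda>c. (r + c) mod q) ` residues_of B q"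
  proof
    fix x assume "x \<in> sum_residues B q R"
    then obtain a b where x: "a \<in> R" "b \<in> B" "x = (a + b) mod q"
      by (auto simp: sum_residues_def)
    show "x \<in> sum_residues B q (R - {r}) \<union> (\<lambda>c. (r + c) mod q) ` residues_of B q"
    proof (cases "a = r")
      case True
      then show ?thesis
        using x by (auto simp: residues_of_def image_image mod_add_right_eq)
    next
      case False
      then show ?thesis
        using x by (auto intro: sum_residuesI)
    qed
  qed
  moreover have fin: "finite (residues_of B q)" "finite (sum_residues B q (R - {r}))"
    using assms by (simp_all add: finite_residues_of finite_sum_residues)
  ultimately have "card (sum_residues B q R)
      \<le> card (sum_residues B q (R - {r}) \<union> (\<lambda>c. (r + c) mod q) ` residues_of B q)"
    by (intro card_mono) auto
  also have "\<dots> \<le> card (sum_residues B q (R - {r})) + card ((\<lambda>c. (r + c) mod q) ` residues_of B q)"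
    by (rule card_Un_le)
  also have "card ((\<lambda>c. (r + c) mod q) ` residues_of B q) \<le> card (residues_of B q)"
    using fin(1) by (rule card_image_le)
  finally show ?thesis by simp
qed

text \<open>Take \<open>R'\<close> of least size with ratio still at least \<open>\<alpha>\<close>.
  Deleting one more residue falls below \<open>\<alpha>\<close>, while a single deletion costs at
  most \<open>card (residues_of B q) / q\<close>. If \<open>R'\<close> is empty, the ratio is
  0.\<close>

lemma exists_subset_sum_residues:
  fixes \<alpha> :: real
  assumes "R \<subseteq> {..<q}" and "0 < q" and "\<alpha> \<le> card (sum_residues B q R) / q" and "0 \<le> \<alpha>"
  obtains R' where "R' \<subseteq> R" and "\<alpha> \<le> card (sum_residues B q R') / q"
    and "card (sum_residues B q R') / q \<le> \<alpha> + card (residues_of B q) / q"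
proof -
  let ?P = "\<lambda>R'. R' \<subseteq> R \<and> \<alpha> \<le> card (sum_residues B q R') / q"
  define R' where "R' = arg_min card ?P"
  have "?P R" using assms(3) by simp
  note arg_min = arg_min_nat_lemma[of ?P R card, OF this, folded R'_def]
  have R': "?P R'" by (rule conjunct1[OF arg_min])
  have min: "card R' \<le> card Q" if "?P Q" for Q
    by (rule mp[OF spec[OF conjunct2[OF arg_min]] that])
  have fin: "finite R'"
    using R' assms(1) by (meson finite_lessThan finite_subset)
  have "card (sum_residues B q R') / q \<le> \<alpha> + card (residues_of B q) / q"
  proof (cases "R' = {}")
    case True
    then show ?thesis using assms(4) by (simp add: sum_residues_def)
  next
    case False
    then obtain r where r: "r \<in> R'" by blast
    then have "card (R' - {r}) < card R'"
      using fin by (meson card_Diff1_less)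
    then have "card (sum_residues B q (R' - {r})) / q < \<alpha>"
      using min[of "R' - {r}"] R' by (meson Diff_subset not_le order.trans)
    moreover have "real (card (sum_residues B q R'))
        \<le> real (card (sum_residues B q (R' - {r}))) + real (card (residues_of B q))"
      using card_sum_residues_remove[OF assms(2), of B R' r] by linarith
    then have "card (sum_residues B q R') / q
        \<le> card (sum_residues B q (R' - {r})) / q + card (residues_of B q) / q"
      unfolding add_divide_distrib[symmetric] by (rule divide_right_mono) simp
    ultimately show ?thesis by linarith
  qed
  then show ?thesis using R' that by blast
qed

text \<open>Replacing \<open>R\<close> by all its lifts modulo \<open>q'\<close> loses no density:
  if \<open>x\<close> is congruent to \<open>r + b\<close> modulo \<open>q\<close>, then
  \<open>x - b\<close> modulo \<open>q'\<close> is a lift of \<open>r\<close>. Hence the lower bound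
  \<open>\<alpha>\<close> survives the passage to the next modulus, where deletion can start
  again.\<close>

lemma card_sum_residues_refine:
  assumes R: "R \<subseteq> {..<q}" and "q dvd q'" and "0 < q'"
  shows "card (sum_residues B q R) / q \<le> card (sum_residues B q' (periodic_set q R \<inter> {..<q'})) / q'"
proof -
  obtain t where t: "q' = q * t" using assms(2) by blast
  then have pos: "0 < q" "0 < t" using assms(3) by simp_all
  let ?S = "sum_residues B q R" and ?R' = "periodic_set q R \<inter> {..<q'}"
  have "periodic_set q ?S \<inter> {..<q * t} \<subseteq> sum_residues B q' ?R'"
  proof
    fix x assume x: "x \<in> periodic_set q ?S \<inter> {..<q * t}"
    then obtain r b where rb: "r \<in> R" "b \<in> B" "x mod q = (r + b) mod q"
      by (auto simp: periodic_set_def sum_residues_def)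
    \<comment> \<open>\<open>(q' - 1) * b\<close> plays the role of \<open>- b\<close> modulo both \<open>q\<close> and \<open>q'\<close>.\<close>
    define r' where "r' = (x + (q' - 1) * b) mod q'"
    have eq: "(q' - 1) * b + b = q' * b"
      using assms(3) by (simp add: algebra_simps flip: mult_Suc)
    have "r' mod q = (x + (q' - 1) * b) mod q"
      unfolding r'_def using assms(2) by (rule mod_mod_cancel)
    also have "\<dots> = (r + b + (q' - 1) * b) mod q"
      by (metis mod_add_left_eq rb(3))
    also have "r + b + (q' - 1) * b = r + q * (t * b)"
      using eq t by (simp add: algebra_simps)
    also have "(r + q * (t * b)) mod q = r"
      using R rb(1) by auto
    finally have "r' \<in> ?R'"
      using rb(1) assms(3) by (simp add: periodic_set_def r'_def)
    moreover have "(r' + b) mod q' = x"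
    proof -
      have "(r' + b) mod q' = (x + ((q' - 1) * b + b)) mod q'"
        by (simp add: r'_def mod_add_left_eq add.assoc)
      also have "\<dots> = x"
        unfolding eq using x t by simp
      finally show ?thesis .
    qed
    ultimately show "x \<in> sum_residues B q' ?R'"
      using sum_residuesI[OF _ rb(2), of r' ?R' q'] by simp
  qed
  then have "card (periodic_set q ?S \<inter> {..<q * t}) \<le> card (sum_residues B q' ?R')"
    using assms(3) by (intro card_mono finite_sum_residues)
  then have "t * card ?S \<le> card (sum_residues B q' ?R')"
    using card_periodic_set_below[OF sum_residues_subset[OF pos(1)], of B R t] by simp
  then have "real t * real (card ?S) \<le> real (card (sum_residues B q' ?R'))"
    by (simp only: flip: of_nat_mult of_nat_le_iff[where 'a = real])
  then show ?thesis
    using pos by (simp add: t field_simps)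
qed

section \<open>From sparse residues to prescribed sumset densities\<close>

lemma has_density_zero_of_residues:
  assumes "\<And>k. 0 < q k" and "(\<lambda>k. card (residues_of B (q k)) / q k) \<longlonglongrightarrow> 0"
  shows "has_density B 0"
proof (rule order_tendstoI)
  fix a :: real assume "a < 0"
  then show "\<forall>\<^sub>F n in sequentially. a < density_ratio B n"
    using density_ratio_nonneg[of B] by (intro always_eventually allI) (rule order.strict_trans2)
next
  fix a :: real assume "0 < a"
  then obtain k where k: "card (residues_of B (q k)) / q k < a"
    using eventually_happens'[OF sequentially_bot order_tendstoD(2)[OF assms(2)]] by blast
  \<comment> \<open>\<open>B\<close> lies in the union of its residue classes modulo
    \<open>q k\<close>, whose density is less than \<open>a\<close>.\<close>
  have "has_density (periodic_set (q k) (residues_of B (q k))) (card (residues_of B (q k)) / q k)"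
    by (intro has_density_periodic_set residues_of_subset assms(1))
  from order_tendstoD(2)[OF this k]
  show "\<forall>\<^sub>F n in sequentially. density_ratio B n < a"
  proof eventually_elim
    case (elim n)
    have "density_ratio B n \<le> density_ratio (periodic_set (q k) (residues_of B (q k))) n"
      by (intro density_ratio_mono) (auto simp: periodic_set_def residues_of_def)
    with elim show ?case by linarith
  qed
qed

text \<open>Lift and delete alternately: the lift of \<open>R k\<close> to modulus
  \<open>q (Suc k)\<close> still has sumset ratio at least \<open>\<alpha>\<close>, and deletion
  brings the ratio within the new, smaller error of \<open>\<alpha>\<close>.\<close>

theorem exists_sumset_density:
  fixes \<alpha> :: real and q :: "nat \<Rightarrow> nat"
  assumes \<alpha>: "0 \<le> \<alpha>" "\<alpha> \<le> 1" and B: "B \<noteq> {}"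
    and pos: "\<And>k. 0 < q k" and dvd: "\<And>k. q k dvd q (Suc k)"
    and lim: "(\<lambda>k. card (residues_of B (q k)) / q k) \<longlonglongrightarrow> 0"
  obtains A d where "has_density A d" and "has_density (A + B) \<alpha>"
proof -
  let ?s = "\<lambda>k R. card (sum_residues B (q k) R) / q k"
  let ?P = "\<lambda>k R. R \<subseteq> {..<q k} \<and> \<alpha> \<le> ?s k R \<and> ?s k R \<le> \<alpha> + card (residues_of B (q k)) / q k"
  have "\<exists>R. \<forall>k. ?P k (R k) \<and> R (Suc k) \<subseteq> periodic_set (q k) (R k)"
  \<comment> \<open>The lower bound in \<open>?P\<close> keeps the recursion going, the upper bound
    forces convergence to \<open>\<alpha>\<close>, and the relation \<open>Q\<close> makes the
    periodic sets nested.\<close>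
  proof (rule dependent_nat_choice[where P = ?P and Q = "\<lambda>k R R'. R' \<subseteq> periodic_set (q k) R"])
    obtain b where b: "b \<in> B" using B by blast
    \<comment> \<open>Modulus 1 with residue 0 describes all of the naturals; its sumset ratio is 1,
      so \<open>\<alpha> \<le> 1\<close> allows the recursion to start.\<close>
    have "sum_residues B 1 {0} = {0}"
      using b by (auto simp: sum_residues_def)
    then have "\<alpha> \<le> card (sum_residues B 1 {0}) / 1"
      using \<alpha>(2) by simp
    also have "\<dots> \<le> ?s 0 (periodic_set 1 {0} \<inter> {..<q 0})"
      using card_sum_residues_refine[of "{0}" 1 "q 0" B] pos by simp
    finally obtain R where "R \<subseteq> periodic_set 1 {0} \<inter> {..<q 0}" "\<alpha> \<le> ?s 0 R"
      "?s 0 R \<le> \<alpha> + card (residues_of B (q 0)) / q 0"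
      using exists_subset_sum_residues[OF Int_lower2 pos _ \<alpha>(1)] by blast
    then show "\<exists>R. ?P 0 R"
      by blast
  next
    fix R k assume R: "?P k R"
    then have "\<alpha> \<le> ?s (Suc k) (periodic_set (q k) R \<inter> {..<q (Suc k)})"
      using card_sum_residues_refine[OF _ dvd pos, of R k B] by linarith
    then obtain R' where "R' \<subseteq> periodic_set (q k) R \<inter> {..<q (Suc k)}" "\<alpha> \<le> ?s (Suc k) R'"
      "?s (Suc k) R' \<le> \<alpha> + card (residues_of B (q (Suc k))) / q (Suc k)"
      using exists_subset_sum_residues[OF Int_lower2 pos _ \<alpha>(1)] by blast
    then show "\<exists>R'. ?P (Suc k) R' \<and> R' \<subseteq> periodic_set (q k) R"
      by blast
  qed
  then obtain R where R: "\<And>k. ?P k (R k)" and nested: "\<And>k. R (Suc k) \<subseteq> periodic_set (q k) (R k)"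
    by blast
  define T where "T k = periodic_set (q k) (R k)" for k
  have "T (Suc k) \<subseteq> T k" for k
    using nested[of k] mod_mod_cancel[OF dvd[of k]] by (auto simp: T_def periodic_set_def)
  then have decr: "decseq T"
    by (rule decseq_SucI)
  have t: "has_density (T k) (card (R k) / q k)" for k
    unfolding T_def using R pos by (intro has_density_periodic_set) blast+
  \<comment> \<open>The densities of the nested sets \<open>T k\<close> decrease and are
    nonnegative, so they converge; their limit \<open>d\<close> becomes the density of
    \<open>A\<close>.\<close>
  have "decseq (\<lambda>k. card (R k) / q k)"
  proof (rule decseq_SucI)
    fix k
    have "density_ratio (T (Suc k)) n \<le> density_ratio (T k) n" for n
      using decr by (intro density_ratio_mono) (auto simp: decseq_Suc_iff)
    then show "card (R (Suc k)) / q (Suc k) \<le> card (R k) / q k"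
      by (intro LIMSEQ_le[OF t t]) auto
  qed
  then obtain d where d: "(\<lambda>k. card (R k) / q k) \<longlonglongrightarrow> d"
    by (rule decseq_convergent[of _ 0]) simp_all
  have s: "has_density (T k + B) (?s k (R k))" for k
    unfolding T_def using R pos by (intro has_density_periodic_set_plus) blast+
  have "(\<lambda>k. \<alpha> + card (residues_of B (q k)) / q k) \<longlonglongrightarrow> \<alpha>"
    using tendsto_add[OF tendsto_const lim, of \<alpha>] by simp
  then have e: "(\<lambda>k. ?s k (R k)) \<longlonglongrightarrow> \<alpha>"
    by (rule tendsto_sandwich[OF _ _ tendsto_const, rotated 2]) (use R in auto)
  show ?thesis
    using has_density_decreasing_limit[OF decr has_density_zero_of_residues[OF pos lim] t d s e] that
    by blast
qed

section \<open>Residues of the primes modulo factorials\<close>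

text \<open>
  With \<open>q = n!\<close>, the terms \<open>\<phi>(q\<^sup>2 / m) = \<phi>(q\<^sup>2) / m\<close> for \<open>1 \<le> m \<le> n\<close> all occur in the sum of
  \<open>\<phi>\<close> over the divisors of \<open>q\<^sup>2\<close>, which equals \<open>q\<^sup>2\<close>.
\<close>

lemma totient_fact_mult_harm_le: "real (totient (fact n)) * harm n \<le> fact n"
proof -
  define q :: nat where "q = fact n"
  have q: "q > 0" by (simp add: q_def)
  have tot: "real (totient (q * q div m)) = real q * real (totient q) / real m"
    if "m \<in> {1..n}" for m
  proof -
    have "m dvd q" unfolding q_def using that by (intro dvd_fact) auto
    then obtain c where c: "q = m * c" by blast
    with q have pos: "0 < m" "0 < c" by simp_all
    have "q * q div m = c * q" using pos by (simp add: c)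
    \<comment> \<open>As \<open>m\<close> divides \<open>c * q\<close>, the gcd formula for the
      totient reduces to \<open>\<phi>(m * (c * q)) = m * \<phi>(c * q)\<close>. Since
      \<open>m * (c * q)\<close> is the square of \<open>q\<close>, the left side is also
      \<open>q * \<phi>(q)\<close>.\<close>
    moreover have "gcd m (c * q) = m"
      using c by (intro gcd_nat.absorb1) simp
    then have "totient (m * (c * q)) * totient m = totient m * totient (c * q) * m"
      using totient_gcd[of m "c * q"] by simp
    then have "totient (m * (c * q)) = totient (c * q) * m"
      using pos by simp
    moreover have "m * (c * q) = q ^ Suc 1" by (simp add: c)
    then have "totient (m * (c * q)) = q * totient q"
      by (simp only: totient_power_Suc power_one_right)
    ultimately have "real q * real (totient q) = real (totient (q * q div m)) * real m"
      by (simp flip: of_nat_mult)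
    then show ?thesis using pos by simp
  qed
  have "(\<lambda>m. q * q div m) ` {1..n} \<subseteq> {d. d dvd q * q}"
  proof safe
    fix m assume "m \<in> {1..n}"
    then have "m dvd q * q" unfolding q_def by (intro dvd_mult dvd_fact) auto
    then show "q * q div m dvd q * q" by (metis dvd_triv_left dvd_mult_div_cancel mult.commute)
  qed
  moreover have "inj_on (\<lambda>m. q * q div m) {1..n}"
  proof (rule inj_on_inverseI[of _ "\<lambda>d. q * q div d"])
    fix m assume "m \<in> {1..n}"
    then have "m dvd q * q" unfolding q_def by (intro dvd_mult dvd_fact) auto
    then show "q * q div (q * q div m) = m"
      using q by (metis dvd_div_mult_self less_numeral_extra(3) mult_is_0 nonzero_mult_div_cancel_left)
  qed
  ultimately have "(\<Sum>m\<in>{1..n}. totient (q * q div m)) \<le> (\<Sum>d | d dvd q * q. totient d)"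
    using q by (subst sum.reindex[unfolded comp_def, symmetric, where g = totient])
      (auto intro!: sum_mono2)
  also have "\<dots> = q * q" by (rule totient_divisor_sum)
  finally have "real (\<Sum>m\<in>{1..n}. totient (q * q div m)) \<le> real (q * q)"
    by (rule of_nat_mono)
  also have "real (\<Sum>m\<in>{1..n}. totient (q * q div m)) = real q * (real (totient q) * harm n)"
    unfolding harm_def of_nat_sum sum_distrib_left using tot
    by (intro sum.cong) (simp_all add: divide_simps)
  finally have "real (totient q) * harm n \<le> real q"
    using q by simp
  then show ?thesis by (simp add: q_def)
qed

text \<open>A prime either divides \<open>n!\<close>, so that it and its residue are at most
  \<open>n\<close>, or is coprime to \<open>n!\<close>, so that its residue is too.\<close>

lemma card_residues_of_primes_le:
  "card (residues_of {p. prime p} (fact n)) \<le> totient (fact n) + Suc n"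
proof -
  have "p mod fact n \<in> totatives (fact n) \<union> {..n}" if "prime p" for p :: nat
  proof (cases "p dvd fact n")
    case True
    then have "p \<le> n" using that by (simp add: prime_dvd_fact_iff)
    then show ?thesis using mod_less_eq_dividend[of p] le_trans by blast
  next
    case False
    then have "coprime (p mod fact n) (fact n)"
      using that by (simp add: prime_imp_coprime)
    moreover have "p mod fact n \<le> fact n" by (simp add: less_imp_le)
    \<comment> \<open>Residue 0 is never a totative but lies in \<open>{..n}\<close>; in this case
      it occurs only when \<open>fact n = 1\<close>.\<close>
    ultimately show ?thesis
      by (cases "p mod fact n = 0") (auto simp: in_totatives_iff)
  qed
  then have "card (residues_of {p. prime p} (fact n)) \<le> card (totatives (fact n) \<union> {..n})"
    unfolding residues_of_def by (intro card_mono) auto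
  also have "\<dots> \<le> totient (fact n) + Suc n"
    using card_Un_le[of "totatives (fact n)" "{..n}"] by (simp add: totient_def)
  finally show ?thesis .
qed

text \<open>The totatives contribute at most the reciprocal of the harmonic number, which tends to 0
  because the harmonic series diverges; the small residues contribute
  \<open>(n + 1) / n!\<close>.\<close>

lemma residues_of_primes_fact_tendsto_0:
  "(\<lambda>n. card (residues_of {p. prime p} (fact n)) / (fact n :: nat)) \<longlonglongrightarrow> 0"
proof (rule tendsto_sandwich[OF _ _ tendsto_const])
  show "\<forall>\<^sub>F n in sequentially. card (residues_of {p. prime p} (fact n)) / (fact n :: nat)
      \<le> inverse (harm n) + (real n / fact n + 1 / fact n)"
    using eventually_gt_at_top[of 0]
  proof eventually_elim
    case (elim n)
    then have "harm n > (0 :: real)" by simp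
    then have "real (totient (fact n)) / fact n \<le> inverse (harm n)"
      using totient_fact_mult_harm_le[of n] by (simp add: field_simps)
    moreover have "card (residues_of {p. prime p} (fact n)) / (fact n :: nat)
        \<le> real (totient (fact n) + Suc n) / fact n"
      using card_residues_of_primes_le[of n] by (simp add: divide_right_mono del: of_nat_add)
    ultimately show ?case by (simp add: add_divide_distrib)
  qed
  have inv: "(\<lambda>n. 1 / fact n :: real) \<longlonglongrightarrow> 0"
    using summable_LIMSEQ_zero[OF summable_exp[of "1::real"]] by (simp add: divide_simps)
  \<comment> \<open>After the index shift the quotient is \<open>1 / n!\<close>.\<close>
  have "(\<lambda>n. real (Suc n) / fact (Suc n)) \<longlonglongrightarrow> 0"
    using inv by (simp add: field_simps del: of_nat_Suc)
  then have "(\<lambda>n. real n / fact n) \<longlonglongrightarrow> 0"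
    by (rule LIMSEQ_imp_Suc)
  then show "(\<lambda>n. inverse (harm n) + (real n / fact n + 1 / fact n) :: real) \<longlonglongrightarrow> 0"
    using tendsto_add[OF tendsto_inverse_0_at_top[OF harm_at_top] tendsto_add[OF _ inv]] by simp
qed simp

section \<open>Sumsets with the primes, along the divisibility chain of factorials\<close>

theorem theorem1p1:
  fixes \<alpha> :: real
  assumes "0 \<le> \<alpha>" and "\<alpha> \<le> 1"
  shows "\<exists>A :: nat set.
           has_asymptotic_density A \<and>
           has_asymptotic_density (A + {p :: nat. prime p}) \<and>
           asymptotic_density (A + {p :: nat. prime p}) = \<alpha>"
proof -
  have "fact k dvd (fact (Suc k) :: nat)" for k
    by (intro fact_dvd) simp
  moreover have "{p :: nat. prime p} \<noteq> {}"
    using two_is_prime_nat by blast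
  moreover have "(0 :: nat) < fact k" for k
    by simp
  ultimately obtain A d where "has_density A d" "has_density (A + {p. prime p}) \<alpha>"
    using exists_sumset_density[of \<alpha> "{p. prime p}" fact] assms residues_of_primes_fact_tendsto_0
    by metis
  then show ?thesis
    unfolding has_asymptotic_density_def asymptotic_density_def
    using convergentI limI by blast
qed

end
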